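(* Let $n\ge 2$. Among all trees $T$ of order $n$ and all vertices $r\in V(T)$, the maximum value of $RC(r)$ is $\frac{n(n-1)(4n-5)}{6}$, and it is attained when $T$ is a path and $r$ is one of its endpoints.
   Context: The simple random walk moves at each step to a uniformly random neighbour; $H_{vw}$ is the expected number of steps for the walk started at $v$ to first reach $w$ ($H_{vv}=0$). The reverse cover cost is $RC(r)=\sum_{w\in V(T)} H_{wr}$. *)

theory Defs
  imports "HOL-Probability.Probability" "Graph_Theory.Graph_Theory"
begin

text \<open>
  A finite simple undirected graph is a symmetric loop-free pair digraph
  (locale \<^locale>\<open>pair_graph\<close>). In such a digraph traversing an edge back and
  forth is a directed cycle of length 2, so \<^const>\<open>Digraph_Component.tree\<close> does not
  describe undirected trees; the cycles of the undirected graph are the directed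
  cycles of length at least 3.
\<close>

definition undirected_tree :: "'a pair_pre_digraph \<Rightarrow> bool" where
  "undirected_tree T \<longleftrightarrow>
     pair_graph T \<and>
     Digraph_Component.connected (with_proj T) \<and>
     \<not> (\<exists>p. pre_digraph.cycle (with_proj T) p \<and> 3 \<le> length p)"

definition path_graph :: "'a list \<Rightarrow> 'a pair_pre_digraph" where
  "path_graph xs =
     \<lparr> pverts = set xs,
       parcs = (\<Union>i\<in>{i. Suc i < length xs}. {(xs ! i, xs ! Suc i), (xs ! Suc i, xs ! i)}) \<rparr>"

definition neighbours :: "'a pair_pre_digraph \<Rightarrow> 'a \<Rightarrow> 'a set" where
  "neighbours G u = {v. (u, v) \<in> parcs G}"

text \<open>
  Conditional law of the position at time \<open>i\<close> given the positions \<open>\<omega> j\<close>, \<open>j < i\<close>,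
  for the walk started at \<open>v\<close>. (At a vertex without neighbours \<^const>\<open>pmf_of_set\<close> is
  an unspecified distribution; in a tree of order at least 2 this does not occur.)
\<close>

definition walk_kernel ::
    "'a pair_pre_digraph \<Rightarrow> 'a \<Rightarrow> nat \<Rightarrow> (nat \<Rightarrow> 'a) \<Rightarrow> 'a measure" where
  "walk_kernel G v i \<omega> =
     (case i of 0 \<Rightarrow> measure_pmf (return_pmf v)
              | Suc j \<Rightarrow> measure_pmf (pmf_of_set (neighbours G (\<omega> j))))"

interpretation walk: Ionescu_Tulcea "walk_kernel G v" "\<lambda>_. count_space UNIV"
  for G :: "'a pair_pre_digraph" and v :: 'a
proof (rule Ionescu_Tulcea.intro)
  fix i :: nat
  let ?P = "PiM {0..<i} (\<lambda>_. count_space UNIV) :: (nat \<Rightarrow> 'a) measure"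
  show "walk_kernel G v i \<in> measurable ?P (subprob_algebra (count_space UNIV))"
  proof (cases i)
    case 0
    then show ?thesis
      by (simp add: walk_kernel_def[abs_def])
  next
    case (Suc j)
    have 1: "(\<lambda>\<omega>. \<omega> j) \<in> measurable ?P (count_space UNIV)"
      by (rule measurable_component_singleton) (simp add: Suc)
    have 2: "(\<lambda>u. measure_pmf (pmf_of_set (neighbours G u)))
        \<in> measurable (count_space UNIV) (subprob_algebra (count_space UNIV))"
      by (simp add: measure_pmf_in_subprob_algebra)
    from measurable_compose[OF 1 2] show ?thesis
      by (simp add: Suc walk_kernel_def[abs_def])
  qed
next
  fix i :: nat and \<omega> :: "nat \<Rightarrow> 'a"
  show "prob_space (walk_kernel G v i \<omega>)"
    by (cases i) (simp_all add: walk_kernel_def measure_pmf.prob_space_axioms)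
qed

text \<open>The law, on the space of infinite trajectories, of the simple random walk on \<open>G\<close>
  started at \<open>v\<close>.\<close>

definition simple_random_walk :: "'a pair_pre_digraph \<Rightarrow> 'a \<Rightarrow> (nat \<Rightarrow> 'a) measure" where
  "simple_random_walk G v = walk.PF.lim G v"

text \<open>The value is \<open>\<infinity>\<close> on trajectories that never visit \<open>w\<close>.\<close>

definition first_hit :: "'a \<Rightarrow> (nat \<Rightarrow> 'a) \<Rightarrow> ennreal" where
  "first_hit w \<omega> = (INF k\<in>{k. \<omega> k = w}. of_nat k)"

definition hitting_time :: "'a pair_pre_digraph \<Rightarrow> 'a \<Rightarrow> 'a \<Rightarrow> ennreal" where
  "hitting_time G v w = (\<integral>\<^sup>+ \<omega>. first_hit w \<omega> \<partial>simple_random_walk G v)"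

lemma hitting_time_self: "hitting_time G v v = 0"
proof -
  let ?M = "\<lambda>_::nat. count_space UNIV :: 'a measure"
  let ?w = "\<lambda>_::nat. undefined :: 'a"
  have w: "?w \<in> space (PiM {} ?M)"
    by (simp add: space_PiM)
  have up: "walk.up_to {0} = Suc 0"
    unfolding walk.up_to_def by (rule Least_equality) (auto simp: Suc_le_eq not_less_eq_eq)
  have C: "walk.C G v 0 (Suc 0) ?w = walk.eP G v 0 ?w"
    using bind_return[OF walk.measurable_eP[of G v 0], of ?w] w by simp
  have "AE x in walk.eP G v 0 ?w. x 0 = v"
    unfolding walk.eP_def
  proof (subst AE_distr_iff)
    show "fun_upd ?w 0 \<in> measurable (walk_kernel G v 0 ?w) (PiM {0..<Suc 0} ?M)"
      by (rule measurable_fun_upd[where J="{}"]) (auto simp: walk_kernel_def)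
    show "{x \<in> space (PiM {0..<Suc 0} ?M). x 0 = v} \<in> sets (PiM {0..<Suc 0} ?M)"
      by measurable
    show "AE x in walk_kernel G v 0 ?w. (?w(0 := x)) 0 = v"
      unfolding walk_kernel_def nat.case by (simp add: AE_measure_pmf_iff)
  qed
  then have "AE x in walk.CI G v {0}. x 0 = v"
    unfolding walk.CI_def up C
    by (subst AE_distr_iff) (auto simp: walk.eP_def intro!: measurable_restrict)
  then have "AE \<omega> in walk.PF.lim G v. restrict \<omega> {0} 0 = v"
    unfolding walk.distr_lim[of "{0}", simplified, symmetric]
    by (subst (asm) AE_distr_iff)
       (auto simp: measurable_cong_sets[OF walk.PF.sets_lim refl] intro!: measurable_restrict)
  then have "AE \<omega> in simple_random_walk G v. \<omega> 0 = v"
    unfolding simple_random_walk_def by simp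
  then have "AE \<omega> in simple_random_walk G v. first_hit v \<omega> = 0"
  proof eventually_elim
    case (elim \<omega>)
    then have "first_hit v \<omega> \<le> of_nat 0"
      unfolding first_hit_def by (intro INF_lower) simp
    then show ?case by simp
  qed
  then show ?thesis
    unfolding hitting_time_def using nn_integral_cong_AE[of "first_hit v" "\<lambda>_. 0"] by simp
qed

definition reverse_cover_cost :: "'a pair_pre_digraph \<Rightarrow> 'a \<Rightarrow> ennreal" where
  "reverse_cover_cost G r = (\<Sum>w\<in>pverts G. hitting_time G w r)"

end

theory Submission
  imports Defs
begin

text \<open>
  On a connected graph the hitting times of \<open>r\<close> are the unique solution of the Poisson equation:
  at every vertex \<open>v\<close> other than \<open>r\<close> the differences \<open>g v - g u\<close> over the neighbours \<open>u\<close> sum to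
  the degree, and \<open>g r = 0\<close>. On a tree rooted at \<open>r\<close> the equation is solved by removing leaves one
  at a time, lumping the removed vertices into their parents. A leaf representing \<open>s\<close> original
  vertices contributes \<open>s (2 s - 1)\<close> to the sum of all hitting times, and the leaf removed at
  step \<open>i\<close> represents at most \<open>i\<close> vertices, so the reverse cover cost is at most the sum of
  \<open>i (2 i - 1)\<close> for \<open>1 \<le> i < n\<close>. On a path the hitting time of an endpoint from distance \<open>i\<close> is
  \<open>i (2 (n - 1) - i)\<close>, and these add up to the same value.
\<close>

section \<open>Hitting times of the walk\<close>

text \<open>Transition operator of the walk killed on reaching \<open>w\<close>.\<close>

definition killed_step ::
    "'a pair_pre_digraph \<Rightarrow> 'a \<Rightarrow> ('a \<Rightarrow> ennreal) \<Rightarrow> 'a \<Rightarrow> ennreal" where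
  "killed_step G w f u =
     (if u = w then 0 else \<integral>\<^sup>+x. f x \<partial>measure_pmf (pmf_of_set (neighbours G u)))"

text \<open>The probability of avoiding \<open>w\<close> at all times up to \<open>k\<close>. It is
  defined by powers of an operator, so that splitting off the first step is mere unfolding.\<close>

definition survival :: "'a pair_pre_digraph \<Rightarrow> 'a \<Rightarrow> nat \<Rightarrow> 'a \<Rightarrow> ennreal" where
  "survival G w k = (killed_step G w ^^ k) (\<lambda>u. if u = w then 0 else 1)"

text \<open>\<open>J\<close> is general because the function is needed both on finite products and
  on the space of infinite trajectories.\<close>

lemma measurable_killed:
  fixes h :: "'a \<Rightarrow> ennreal" and k :: nat
  assumes "{..k} \<subseteq> J"
  shows "(\<lambda>\<omega>. if \<forall>i\<le>k. \<omega> i \<noteq> w then h (\<omega> k) else 0)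
    \<in> borel_measurable (PiM J (\<lambda>_. count_space UNIV))"
proof -
  let ?N = "PiM J (\<lambda>_. count_space UNIV) :: (nat \<Rightarrow> 'a) measure"
  have comp: "(\<lambda>\<omega>. \<omega> i) \<in> measurable ?N (count_space UNIV)" if "i \<le> k" for i
    using that assms by (intro measurable_component_singleton) auto
  have "{\<omega> \<in> space ?N. \<forall>i\<in>{..k}. \<omega> i \<noteq> w} \<in> sets ?N"
  proof (rule sets.sets_Collect_finite_All)
    fix i assume "i \<in> {..k}"
    then have "(\<lambda>\<omega>. \<omega> i) -` (- {w}) \<inter> space ?N \<in> sets ?N"
      by (intro measurable_sets[OF comp]) auto
    also have "(\<lambda>\<omega>. \<omega> i) -` (- {w}) \<inter> space ?N = {\<omega> \<in> space ?N. \<omega> i \<noteq> w}"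
      by auto
    finally show "{\<omega> \<in> space ?N. \<omega> i \<noteq> w} \<in> sets ?N" .
  qed simp
  moreover have "(\<lambda>\<omega>. h (\<omega> k)) \<in> borel_measurable ?N"
    by (rule measurable_compose[OF comp]) auto
  ultimately show ?thesis
    by (intro measurable_If measurable_const) (simp_all only: atMost_iff Ball_def space_borel UNIV_I)
qed

text \<open>Markov property: integrating out the last position replaces \<open>h\<close> at time
  \<open>Suc k\<close> by its killed average at time \<open>k\<close>. The induction on
  \<open>k\<close> therefore has to let \<open>h\<close> vary.\<close>

lemma killed_expectation:
  fixes G :: "'a pair_pre_digraph" and h :: "'a \<Rightarrow> ennreal"
  shows "(\<integral>\<^sup>+\<omega>. (if \<forall>i\<le>k. \<omega> i \<noteq> w then h (\<omega> k) else 0)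
            \<partial>walk.C G v 0 (Suc k) (\<lambda>_. undefined))
       = (killed_step G w ^^ k) (\<lambda>u. if u = w then 0 else h u) v"
proof (induction k arbitrary: h)
  case 0
  let ?M = "\<lambda>_::nat. count_space UNIV :: 'a measure"
  have u: "(\<lambda>_. undefined) \<in> space (PiM {0..<0::nat} ?M)"
    by (simp add: space_PiM)
  have C: "walk.C G v 0 (Suc 0) (\<lambda>_. undefined) = walk.eP G v 0 (\<lambda>_. undefined)"
    using bind_return[OF walk.measurable_eP[of G v 0], of "\<lambda>_. undefined"] u by simp
  have m: "(\<lambda>\<omega>. if \<forall>i\<le>0. \<omega> i \<noteq> w then h (\<omega> 0) else 0) \<in> borel_measurable (PiM {0..<Suc 0} ?M)"
    by (rule measurable_killed) auto
  show ?case
    unfolding C by (subst walk.nn_integral_eP[OF u m]) (simp add: walk_kernel_def)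
next
  case (Suc k)
  let ?M = "\<lambda>_::nat. count_space UNIV :: 'a measure"
  let ?u = "\<lambda>_::nat. undefined :: 'a"
  have u: "?u \<in> space (PiM {0..<0} ?M)"
    by (simp add: space_PiM)
  let ?f = "\<lambda>\<omega>. if \<forall>i\<le>Suc k. \<omega> i \<noteq> w then h (\<omega> (Suc k)) else 0"
  let ?h = "\<lambda>u. if u = w then 0 else h u"
  have if_out: "(\<integral>\<^sup>+x. (if P then F x else 0) \<partial>N) = (if P then \<integral>\<^sup>+x. F x \<partial>N else 0)"
    for P and F :: "'a \<Rightarrow> ennreal" and N
    by simp
  have m: "?f \<in> borel_measurable (PiM {0..<Suc (Suc k)} ?M)"
    by (rule measurable_killed) auto
  have "(\<integral>\<^sup>+\<omega>. ?f \<omega> \<partial>walk.C G v 0 (Suc (Suc k)) ?u)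
      = (\<integral>\<^sup>+\<omega>. (\<integral>\<^sup>+\<omega>'. ?f \<omega>' \<partial>walk.eP G v (Suc k) \<omega>) \<partial>walk.C G v 0 (Suc k) ?u)"
    unfolding walk.C.simps(2)[of G v 0 "Suc k"]
  proof (subst nn_integral_bind[where B = "PiM {0..<Suc (Suc k)} ?M"])
    show "walk.eP G v (0 + Suc k)
        \<in> measurable (walk.C G v 0 (Suc k) ?u) (subprob_algebra (PiM {0..<Suc (Suc k)} ?M))"
      using walk.measurable_eP[of G v "Suc k"]
      unfolding measurable_cong_sets[OF walk.sets_C[OF u] refl] by simp
  qed (simp_all add: m del: walk.C.simps)
  also have "\<dots> = (\<integral>\<^sup>+\<omega>. (if \<forall>i\<le>k. \<omega> i \<noteq> w then killed_step G w ?h (\<omega> k) else 0)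
                    \<partial>walk.C G v 0 (Suc k) ?u)"
  proof (rule nn_integral_cong)
    fix \<omega> assume "\<omega> \<in> space (walk.C G v 0 (Suc k) ?u)"
    then have \<omega>: "\<omega> \<in> space (PiM {0..<Suc k} ?M)"
      using walk.space_C[OF u, of G v "Suc k"] by simp
    have "(\<integral>\<^sup>+\<omega>'. ?f \<omega>' \<partial>walk.eP G v (Suc k) \<omega>)
        = (\<integral>\<^sup>+x. ?f (fun_upd \<omega> (Suc k) x) \<partial>measure_pmf (pmf_of_set (neighbours G (\<omega> k))))"
      by (subst walk.nn_integral_eP[OF \<omega> m]) (simp add: walk_kernel_def)
    also have "\<dots> = (\<integral>\<^sup>+x. (if \<forall>i\<le>k. \<omega> i \<noteq> w then ?h x else 0)
                      \<partial>measure_pmf (pmf_of_set (neighbours G (\<omega> k))))"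
      by (intro nn_integral_cong) (auto simp: le_Suc_eq)
    also have "\<dots> = (if \<forall>i\<le>k. \<omega> i \<noteq> w
        then \<integral>\<^sup>+x. ?h x \<partial>measure_pmf (pmf_of_set (neighbours G (\<omega> k))) else 0)"
      by (rule if_out)
    also have "\<dots> = (if \<forall>i\<le>k. \<omega> i \<noteq> w then killed_step G w ?h (\<omega> k) else 0)"
      by (auto simp: killed_step_def)
    finally show "(\<integral>\<^sup>+\<omega>'. ?f \<omega>' \<partial>walk.eP G v (Suc k) \<omega>) = (if \<forall>i\<le>k. \<omega> i \<noteq> w then killed_step G w ?h (\<omega> k) else 0)" .
  qed
  also have "\<dots> = (killed_step G w ^^ k) (\<lambda>u. if u = w then 0 else killed_step G w ?h u) v"
    by (rule Suc.IH)
  \<comment> \<open>\<open>killed_step\<close> already vanishes at \<open>w\<close>, so the cut-off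
    coming from the induction hypothesis changes nothing.\<close>
  also have "(\<lambda>u. if u = w then 0 else killed_step G w ?h u) = killed_step G w ?h"
    by (auto simp: killed_step_def)
  finally show ?case
    by (simp only: funpow_Suc_right comp_apply)
qed

text \<open>The law on trajectories is a projective limit; its marginal on the first
  \<open>n\<close> times is the \<open>n\<close>-fold composition of the kernels.\<close>

lemma nn_integral_simple_random_walk:
  fixes G :: "'a pair_pre_digraph"
  assumes f: "f \<in> borel_measurable (PiM {0..<n} (\<lambda>_. count_space UNIV))"
  shows "(\<integral>\<^sup>+\<omega>. f (restrict \<omega> {0..<n}) \<partial>simple_random_walk G v)
       = (\<integral>\<^sup>+\<omega>. f \<omega> \<partial>walk.C G v 0 n (\<lambda>_. undefined))"
proof -
  let ?M = "\<lambda>_::nat. count_space UNIV :: 'a measure"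
  let ?u = "\<lambda>_::nat. undefined :: 'a"
  have u: "?u \<in> space (PiM {0..<0} ?M)"
    by (simp add: space_PiM)
  have up: "walk.up_to {0..<n} = n"
    unfolding walk.up_to_def by (rule Least_equality) (auto simp: not_le[symmetric])
  have "(\<integral>\<^sup>+\<omega>. f (restrict \<omega> {0..<n}) \<partial>simple_random_walk G v)
      = (\<integral>\<^sup>+\<omega>. f \<omega> \<partial>distr (walk.PF.lim G v) (PiM {0..<n} ?M) (\<lambda>\<omega>. restrict \<omega> {0..<n}))"
    unfolding simple_random_walk_def
    by (subst nn_integral_distr)
       (auto simp: f measurable_cong_sets[OF walk.PF.sets_lim refl] intro!: measurable_restrict)
  also have "\<dots> = (\<integral>\<^sup>+\<omega>. f \<omega> \<partial>walk.CI G v {0..<n})"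
    by (subst walk.distr_lim) auto
  also have "\<dots> = (\<integral>\<^sup>+\<omega>. f (restrict \<omega> {0..<n}) \<partial>walk.C G v 0 n ?u)"
    unfolding walk.CI_def up
    by (subst nn_integral_distr)
       (use walk.sets_C[OF u, of G v n] in \<open>auto simp: f cong: measurable_cong_sets intro!: measurable_restrict\<close>)
  also have "\<dots> = (\<integral>\<^sup>+\<omega>. f \<omega> \<partial>walk.C G v 0 n ?u)"
    using walk.nn_integral_C[of n n f 0 ?u G v] f u by simp
  finally show ?thesis .
qed

text \<open>The case of the constant function 1 in \<open>killed_expectation\<close>, which gives
  \<open>survival\<close> its probabilistic meaning.\<close>

lemma nn_integral_survival:
  "(\<integral>\<^sup>+\<omega>. (if \<forall>i\<le>k. \<omega> i \<noteq> w then 1 else 0) \<partial>simple_random_walk G v) = survival G w k v"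
proof -
  let ?f = "\<lambda>\<omega> :: nat \<Rightarrow> 'a. if \<forall>i\<le>k. \<omega> i \<noteq> w then 1 else 0 :: ennreal"
  have "?f \<in> borel_measurable (PiM {0..<Suc k} (\<lambda>_. count_space UNIV))"
    by (rule measurable_killed) auto
  from nn_integral_simple_random_walk[OF this, of G v]
  have "(\<integral>\<^sup>+\<omega>. ?f (restrict \<omega> {0..<Suc k}) \<partial>simple_random_walk G v) = survival G w k v"
    unfolding survival_def killed_expectation[where h = "\<lambda>_. 1"] .
  moreover have "?f (restrict \<omega> {0..<Suc k}) = ?f \<omega>" for \<omega>
    by simp
  ultimately show ?thesis
    by simp
qed

text \<open>The \<open>k\<close>-th term is 1 exactly when the first visit comes after time
  \<open>k\<close>. If \<open>w\<close> is never visited, the series diverges and the infimum over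
  the empty set is infinite as well.\<close>

lemma first_hit_conv_suminf:
  "first_hit w \<omega> = (\<Sum>k. if \<forall>i\<le>k. \<omega> i \<noteq> w then 1 else 0)"
proof (cases "\<exists>k. \<omega> k = w")
  case True
  define m where "m = (LEAST k. \<omega> k = w)"
  have m: "\<omega> m = w" "\<And>i. i < m \<Longrightarrow> \<omega> i \<noteq> w"
    using True unfolding m_def by (auto intro: LeastI_ex dest: not_less_Least)
  have "first_hit w \<omega> = of_nat m"
    unfolding first_hit_def
  proof (rule antisym)
    show "(INF k\<in>{k. \<omega> k = w}. of_nat k) \<le> (of_nat m :: ennreal)"
      using m by (intro INF_lower) auto
    show "(of_nat m :: ennreal) \<le> (INF k\<in>{k. \<omega> k = w}. of_nat k)"
      using m by (intro INF_greatest) (auto simp: not_less[symmetric])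
  qed
  also have "\<dots> = (\<Sum>k<m. if \<forall>i\<le>k. \<omega> i \<noteq> w then 1 else 0 :: ennreal)"
    using m by (simp add: sum.If_cases Int_absorb2 subset_eq)
  also have "\<dots> = (\<Sum>k. if \<forall>i\<le>k. \<omega> i \<noteq> w then 1 else 0)"
    using m by (intro suminf_finite[symmetric]) (auto simp: not_less)
  finally show ?thesis .
next
  case False
  have "(\<Sum>k. 1 :: ennreal) = \<infinity>"
    by (simp add: suminf_eq_SUP ennreal_SUP_of_nat_eq_top)
  with False show ?thesis
    by (simp add: first_hit_def)
qed

text \<open>Tail-sum formula for the expectation; series and integral commute by
  nonnegativity.\<close>

lemma hitting_time_conv_survival: "hitting_time G v w = (\<Sum>k. survival G w k v)"
proof -
  have "(\<lambda>\<omega>. if \<forall>i\<le>k. \<omega> i \<noteq> w then 1 else 0 :: ennreal) \<in> borel_measurable (simple_random_walk G v)"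
    for k
    unfolding simple_random_walk_def measurable_cong_sets[OF walk.PF.sets_lim refl]
    by (rule measurable_killed) auto
  then show ?thesis
    unfolding hitting_time_def first_hit_conv_suminf
    by (subst nn_integral_suminf) (auto simp only: nn_integral_survival)
qed

text \<open>First-step analysis: the term for \<open>k = 0\<close> is 1, and every later term is the
  average of the preceding one over the neighbours. Working in \<open>ennreal\<close> makes
  finiteness irrelevant at this point.\<close>

lemma hitting_time_step:
  assumes "v \<noteq> w"
  shows "hitting_time G v w
       = 1 + (\<integral>\<^sup>+u. hitting_time G u w \<partial>measure_pmf (pmf_of_set (neighbours G v)))"
proof -
  have "hitting_time G v w = survival G w 0 v + (\<Sum>k. survival G w (Suc k) v)"
    using suminf_offset[of "\<lambda>k. survival G w k v" 1]
    by (simp add: hitting_time_conv_survival add.commute)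
  also have "(\<Sum>k. survival G w (Suc k) v)
      = (\<integral>\<^sup>+u. (\<Sum>k. survival G w k u) \<partial>measure_pmf (pmf_of_set (neighbours G v)))"
    using assms by (simp add: survival_def killed_step_def nn_integral_suminf)
  finally show ?thesis
    using assms by (simp add: hitting_time_conv_survival survival_def)
qed

text \<open>Minimality of the hitting time among nonnegative supersolutions: by induction on the
  number of terms, \<open>g\<close> bounds all partial sums of the survival series. A finite
  \<open>g\<close> thus yields finite hitting times.\<close>

lemma hitting_time_le_supersolution:
  assumes closed: "\<And>v. v \<in> V \<Longrightarrow> set_pmf (pmf_of_set (neighbours G v)) \<subseteq> V"
    and super: "\<And>v. v \<in> V \<Longrightarrow> v \<noteq> w \<Longrightarrow>
      1 + (\<integral>\<^sup>+u. g u \<partial>measure_pmf (pmf_of_set (neighbours G v))) \<le> g v"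
    and "v \<in> V"
  shows "hitting_time G v w \<le> g v"
proof -
  have "(\<Sum>k<n. survival G w k v) \<le> g v" for n
    using \<open>v \<in> V\<close>
  proof (induction n arbitrary: v)
    case (Suc n)
    show ?case
    proof (cases "v = w")
      case True
      have "survival G w k w = 0" for k
        by (cases k) (simp_all add: survival_def killed_step_def)
      with True show ?thesis by simp
    next
      case False
      have "(\<Sum>k<Suc n. survival G w k v) = survival G w 0 v + (\<Sum>k<n. survival G w (Suc k) v)"
        by (rule sum.lessThan_Suc_shift)
      also have "(\<Sum>k<n. survival G w (Suc k) v)
          = (\<integral>\<^sup>+u. (\<Sum>k<n. survival G w k u) \<partial>measure_pmf (pmf_of_set (neighbours G v)))"
        using False by (simp add: survival_def killed_step_def nn_integral_sum)
      also have "\<dots> \<le> (\<integral>\<^sup>+u. g u \<partial>measure_pmf (pmf_of_set (neighbours G v)))"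
        using Suc.IH closed[OF Suc.prems]
        by (intro nn_integral_mono_AE) (auto simp: AE_measure_pmf_iff)
      finally have "(\<Sum>k<Suc n. survival G w k v)
          \<le> 1 + (\<integral>\<^sup>+u. g u \<partial>measure_pmf (pmf_of_set (neighbours G v)))"
        using False by (simp add: survival_def add_left_mono)
      also have "\<dots> \<le> g v"
        using super[OF Suc.prems False] .
      finally show ?thesis .
    qed
  qed simp
  then show ?thesis
    unfolding hitting_time_conv_survival by (simp add: suminf_eq_SUP SUP_least)
qed

section \<open>Leaves of trees\<close>

text \<open>Connectedness in the library refers to the symmetrised digraph; as the arcs are
  symmetric already, it reduces to the reflexive transitive closure of the arc relation.\<close>

lemma reachable_mk_symmetric_iff:
  assumes "pair_graph G" and "u \<in> pverts G"
  shows "u \<rightarrow>\<^sup>*\<^bsub>mk_symmetric (with_proj G)\<^esub> v \<longleftrightarrow> (u, v) \<in> (parcs G)\<^sup>*"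
proof -
  interpret pair_graph G by fact
  have "u \<rightarrow>\<^sup>*\<^bsub>mk_symmetric (with_proj G)\<^esub> v \<longleftrightarrow> u \<rightarrow>\<^sup>*\<^bsub>with_proj G\<^esub> v"
    by (rule reachable_mk_symmetric_eq[OF pair_sym_arcs])
  also have "\<dots> \<longleftrightarrow> (u, v) \<in> (parcs G)\<^sup>*"
    using assms(2) by (auto simp: reachable_conv elim: rtranclE dest: in_arcsD2)
  finally show ?thesis .
qed

text \<open>Connectedness as an induction principle, used for the maximum principle and for leaf
  deletion.\<close>

lemma connected_closed_subset:
  assumes "pair_graph G" and "Digraph_Component.connected (with_proj G)"
    and "r \<in> pverts G" and "r \<in> S"
    and closed: "\<And>u v. u \<in> S \<Longrightarrow> (u, v) \<in> parcs G \<Longrightarrow> v \<in> S"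
  shows "pverts G \<subseteq> S"
proof
  fix v assume "v \<in> pverts G"
  then have "r \<rightarrow>\<^sup>*\<^bsub>mk_symmetric (with_proj G)\<^esub> v"
    using assms(2,3) by (simp add: connected_def strongly_connected_def)
  then have "(r, v) \<in> (parcs G)\<^sup>*"
    using reachable_mk_symmetric_iff[OF assms(1,3)] by simp
  then show "v \<in> S"
    by induction (use \<open>r \<in> S\<close> closed in auto)
qed

text \<open>Converse of the induction principle: apply it to the set of vertices reachable from
  \<open>r\<close>, then join any two vertices through \<open>r\<close> by symmetry.\<close>

lemma connectedI_closed_subset:
  assumes "pair_graph G" and r: "r \<in> pverts G"
    and sub: "\<And>S. r \<in> S \<Longrightarrow> (\<And>u v. u \<in> S \<Longrightarrow> (u, v) \<in> parcs G \<Longrightarrow> v \<in> S) \<Longrightarrow> pverts G \<subseteq> S"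
  shows "Digraph_Component.connected (with_proj G)"
proof -
  interpret pair_graph G by fact
  have r_v: "(r, v) \<in> (parcs G)\<^sup>*" if "v \<in> pverts G" for v
    using sub[of "{v. (r, v) \<in> (parcs G)\<^sup>*}"] that by (auto intro: rtrancl_into_rtrancl)
  have "sym ((parcs G)\<^sup>*)"
    by (intro sym_rtrancl symI) (rule arcs_symmetric)
  then have "(u, v) \<in> (parcs G)\<^sup>*" if "u \<in> pverts G" "v \<in> pverts G" for u v
    using r_v that by (meson rtrancl_trans symD)
  then show ?thesis
    using r reachable_mk_symmetric_iff[OF assms(1)]
    by (auto simp: connected_def strongly_connected_def)
qed

text \<open>Keeps \<open>pmf_of_set\<close> away from its unspecified value on the empty
  set.\<close>

lemma connected_neighbours_nonempty:
  assumes "pair_graph G" and "Digraph_Component.connected (with_proj G)"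
    and "2 \<le> card (pverts G)" and "v \<in> pverts G"
  shows "neighbours G v \<noteq> {}"
proof
  assume "neighbours G v = {}"
  then have "pverts G \<subseteq> {v}"
    using assms by (intro connected_closed_subset[of G v]) (auto simp: neighbours_def)
  from card_mono[OF _ this] show False
    using assms(3) by simp
qed

lemma finite_neighbours: "pair_graph G \<Longrightarrow> finite (neighbours G v)"
  and neighbours_subset: "pair_graph G \<Longrightarrow> neighbours G v \<subseteq> pverts G"
proof -
  assume "pair_graph G"
  then interpret pair_graph G .
  show *: "neighbours G v \<subseteq> pverts G"
    by (auto simp: neighbours_def dest: in_arcsD2)
  show "finite (neighbours G v)"
    using * by (rule finite_subset) (rule pair_finite_verts)
qed

text \<open>The leaf differs from \<open>r\<close> so that the root survives every deletion.\<close>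

lemma undirected_tree_leaf:
  assumes T: "undirected_tree T" and n: "2 \<le> card (pverts T)" and r: "r \<in> pverts T"
  obtains l p where "l \<in> pverts T" "l \<noteq> r" "p \<in> pverts T" "p \<noteq> l" "neighbours T l = {p}"
proof -
  from T have "pair_graph T" and con: "Digraph_Component.connected (with_proj T)"
    and acyc: "\<And>c. pre_digraph.cycle (with_proj T) c \<Longrightarrow> length c < 3"
    by (force simp: undirected_tree_def)+
  then interpret pair_graph T by simp
  \<comment> \<open>The far end of a longest path from the root is a leaf: another neighbour would either
     prolong the path or close a cycle.\<close>
  define A where "A = {(q, x). apath r q x}"
  have "finite A"
  proof (rule finite_subset)
    show "A \<subseteq> snd ` {(u, q, x). apath u q x}"
      unfolding A_def by force
    show "finite (snd ` {(u, q, x). apath u q x})"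
      using apaths_finite_triple by (rule finite_imageI)
  qed
  \<comment> \<open>A path of length one from the root ensures that the longest path is nonempty, so
    its far end is not the root.\<close>
  obtain s where s: "(r, s) \<in> parcs T"
    using connected_neighbours_nonempty[OF \<open>pair_graph T\<close> con n r] by (auto simp: neighbours_def)
  then have rs: "apath r [(r, s)] s"
    using r in_arcsD2[OF s] no_loops'[OF s] by (simp add: apath_def awalk_simps)
  obtain q x where q: "apath r q x" and max: "\<And>q' x'. apath r q' x' \<Longrightarrow> length q' \<le> length q"
  proof -
    have "A \<noteq> {}"
      using rs by (auto simp: A_def)
    then obtain m where m: "m \<in> A" "length (fst m) = Max ((\<lambda>m. length (fst m)) ` A)"
      using obtains_MAX[OF \<open>finite A\<close>] by metis
    have "length q' \<le> length (fst m)" if "apath r q' x'" for q' x'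
      unfolding m(2) using \<open>finite A\<close> that by (intro Max_ge) (force simp: A_def)+
    then show thesis
      using that[of "fst m" "snd m"] m(1) by (auto simp: A_def)
  qed
  have "length q \<ge> 1"
    using max[OF rs] by simp
  then have "q \<noteq> []" by auto
  have "awalk r q x" and "distinct (pawalk_verts r q)"
    using q by (simp_all add: apath_def)
  have uniq: "y = fst (last q)" if xy: "(x, y) \<in> parcs T" for y
  proof (cases "y \<in> set (pawalk_verts r q)")
    case False
    have w: "awalk r (q @ [(x, y)]) y"
      using \<open>awalk r q x\<close> xy in_arcsD2[OF xy] by (intro awalk_appendI) (auto simp: awalk_simps)
    then have "apath r (q @ [(x, y)]) y"
      using awalk_verts_append[OF w] False \<open>distinct (pawalk_verts r q)\<close> by (simp add: apath_def)
    from max[OF this] show ?thesis by simp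
  next
    case True
    then obtain q1 q2 where q12: "q = q1 @ q2" "awalk r q1 y" "awalk y q2 x"
      using \<open>awalk r q x\<close> awalk_decomp by blast
    \<comment> \<open>\<open>q2\<close> is the part of the path from \<open>y\<close> to its end
      \<open>x\<close>; the arc back to \<open>y\<close> closes it up.\<close>
    have w: "awalk y (q2 @ [(x, y)]) y"
      using q12(3) xy in_arcsD2[OF xy] by (intro awalk_appendI) (auto simp: awalk_simps)
    have "pawalk_verts r q = butlast (pawalk_verts r q1) @ pawalk_verts y q2"
      using awalk_verts_append2[of r q1 q2 x] \<open>awalk r q x\<close> q12 awlast_of_awalk[OF q12(2)] by auto
    then have "distinct (pawalk_verts y q2)"
      using \<open>distinct (pawalk_verts r q)\<close> by simp
    moreover have "pawalk_verts y q2 = y # tl (pawalk_verts y q2)"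
      using awhd_of_awalk[OF q12(3)] by (metis awalk_verts_non_Nil list.collapse)
    ultimately have "distinct (tl (pawalk_verts y q2) @ [y])"
      by (metis distinct.simps(2) distinct1_rotate rotate1.simps(2))
    moreover have "tl (pawalk_verts y (q2 @ [(x, y)])) = tl (pawalk_verts y q2) @ [y]"
      using awalk_verts_append[OF w] by simp
    ultimately have "cycle (q2 @ [(x, y)])"
      using w unfolding cycle_def by (intro exI[of _ y]) simp
    \<comment> \<open>Only a cycle of length 2 is possible, so \<open>q2\<close> is the last arc of
      the path and \<open>y\<close> its tail.\<close>
    from acyc[OF this] have "length q2 < 2" by simp
    moreover have "q2 \<noteq> []"
      using q12 no_loops'[OF xy] by (auto simp: awalk_simps)
    ultimately obtain e where e: "q2 = [e]"
      by (cases q2) auto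
    then show ?thesis
      using q12 by (auto simp: awalk_simps)
  qed
  have "x \<noteq> r"
    using q \<open>q \<noteq> []\<close> apath_nonempty_ends by blast
  have "awalk r (butlast q @ [last q]) x"
    using \<open>awalk r q x\<close> \<open>q \<noteq> []\<close> by simp
  then have "(fst (last q), x) \<in> parcs T"
    unfolding awalk_append_iff by (auto simp: awalk_simps)
  then have "(x, fst (last q)) \<in> parcs T"
    by (rule arcs_symmetric)
  with uniq have "neighbours T x = {fst (last q)}"
    unfolding neighbours_def by blast
  then show ?thesis
    using that \<open>x \<noteq> r\<close> \<open>(x, fst (last q)) \<in> parcs T\<close>
    by (metis in_arcsD1 in_arcsD2 no_loops')
qed

definition delete_leaf :: "'a pair_pre_digraph \<Rightarrow> 'a \<Rightarrow> 'a pair_pre_digraph" where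
  "delete_leaf T l = \<lparr> pverts = pverts T - {l}, parcs = parcs T \<inter> (- {l}) \<times> (- {l}) \<rparr>"

lemma undirected_tree_delete_leaf:
  assumes T: "undirected_tree T" and "l \<noteq> r" and r: "r \<in> pverts T"
    and l: "neighbours T l = {p}"
  shows "undirected_tree (delete_leaf T l)"
proof -
  let ?T = "delete_leaf T l"
  from T have "pair_graph T" and con: "Digraph_Component.connected (with_proj T)"
    by (simp_all add: undirected_tree_def)
  interpret pair_graph T by fact
  have pg: "pair_graph ?T"
  proof
    show "symmetric (with_proj ?T)"
      by (auto simp: symmetric_def delete_leaf_def intro!: symI arcs_symmetric)
  qed (auto simp: delete_leaf_def in_arcsD1 in_arcsD2 no_loops' dest: in_arcsD1 in_arcsD2 no_loops')
  have "Digraph_Component.connected (with_proj ?T)"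
  proof (rule connectedI_closed_subset[OF pg])
    show "r \<in> pverts ?T"
      using r \<open>l \<noteq> r\<close> by (simp add: delete_leaf_def)
    fix S assume "r \<in> S" and closed: "\<And>u v. u \<in> S \<Longrightarrow> (u, v) \<in> parcs ?T \<Longrightarrow> v \<in> S"
    \<comment> \<open>\<open>l\<close> is adjacent to \<open>p\<close> alone, so placing it on the
      side of \<open>p\<close> keeps the set closed under the arcs of \<open>T\<close>. Since
      \<open>S\<close> may contain \<open>l\<close>, it is removed in the second case.\<close>
    define S' where "S' = (if p \<in> S then insert l S else S - {l})"
    have "(u, l) \<in> parcs T \<Longrightarrow> u = p" "(l, u) \<in> parcs T \<Longrightarrow> u = p" for u
      using l arcs_symmetric by (auto simp: neighbours_def)
    then have "pverts T \<subseteq> S'"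
      using \<open>r \<in> S\<close> \<open>l \<noteq> r\<close> closed
      by (intro connected_closed_subset[OF \<open>pair_graph T\<close> con r])
         (auto simp: S'_def delete_leaf_def split: if_splits)
    then show "pverts ?T \<subseteq> S"
      by (auto simp: S'_def delete_leaf_def split: if_splits)
  qed
  moreover have "subgraph (with_proj ?T) (with_proj T)"
    using pg wf_digraph_axioms
    by (auto simp: subgraph_def delete_leaf_def wf_digraph_wp_iff pair_graph_def pair_digraph_def
        pair_fin_digraph_def)
  then have "pre_digraph.cycle (with_proj T) c" if "pre_digraph.cycle (with_proj ?T) c" for c
    using that by (rule subgraph_cycle)
  ultimately show ?thesis
    using T pg unfolding undirected_tree_def by blast
qed

section \<open>The Poisson equation\<close>

text \<open>A nonnegative solution is a supersolution, hence bounds the hitting times and makes them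
  finite. These solve the same equation, and the maximum principle gives the reverse
  inequality.\<close>

lemma hitting_time_eqI:
  fixes g :: "'a \<Rightarrow> real"
  assumes G: "pair_graph G" and con: "Digraph_Component.connected (with_proj G)"
    and n: "2 \<le> card (pverts G)" and r: "r \<in> pverts G"
    and nonneg: "\<And>v. v \<in> pverts G \<Longrightarrow> 0 \<le> g v" and "g r = 0"
    and poisson: "\<And>v. v \<in> pverts G \<Longrightarrow> v \<noteq> r \<Longrightarrow>
      (\<Sum>u\<in>neighbours G v. g v - g u) = card (neighbours G v)"
    and "v \<in> pverts G"
  shows "hitting_time G v r = ennreal (g v)"
proof -
  let ?N = "neighbours G" and ?V = "pverts G"
  have fin: "finite (?N v)" and sub: "?N v \<subseteq> ?V" for v
    using G by (simp_all add: finite_neighbours neighbours_subset)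
  have "finite ?V"
    using G by (rule pair_fin_digraph.pair_finite_verts[OF pair_digraph.axioms(1)[OF pair_graph.axioms(1)]])
  have ne: "?N v \<noteq> {}" if "v \<in> ?V" for v
    using connected_neighbours_nonempty[OF G con n that] .
  then have pos: "card (?N v) > 0" if "v \<in> ?V" for v
    using fin that by (simp add: card_gt_0_iff)
  have average: "(\<integral>\<^sup>+u. ennreal (f u) \<partial>measure_pmf (pmf_of_set (?N v)))
      = ennreal ((\<Sum>u\<in>?N v. f u) / card (?N v))"
    if "v \<in> ?V" and f: "\<And>u. u \<in> ?V \<Longrightarrow> 0 \<le> f u" for v and f :: "'a \<Rightarrow> real"
  proof -
    have "(\<Sum>u\<in>?N v. ennreal (f u)) = ennreal (\<Sum>u\<in>?N v. f u)"
      using f sub by (intro sum_ennreal) blast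
    then show ?thesis
      using pos[OF that(1)] f sub
      by (subst nn_integral_pmf_of_set[OF ne[OF that(1)] fin])
         (auto simp: ennreal_of_nat_eq_real_of_nat intro!: divide_ennreal sum_nonneg)
  qed
  have le: "hitting_time G v r \<le> ennreal (g v)" if "v \<in> ?V" for v
  proof (rule hitting_time_le_supersolution[where V = ?V])
    fix v assume v: "v \<in> ?V"
    show "set_pmf (pmf_of_set (?N v)) \<subseteq> ?V"
      using ne[OF v] fin sub by simp
    assume "v \<noteq> r"
    then have "1 + (\<Sum>u\<in>?N v. g u) / card (?N v) = g v"
      using poisson[OF v] pos[OF v] by (simp add: sum_subtractf field_simps)
    moreover have "0 \<le> (\<Sum>u\<in>?N v. g u) / card (?N v)"
      using nonneg sub by (intro divide_nonneg_nonneg sum_nonneg) auto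
    ultimately show "1 + (\<integral>\<^sup>+u. ennreal (g u) \<partial>measure_pmf (pmf_of_set (?N v))) \<le> ennreal (g v)"
      using average[of v g] v nonneg by (simp flip: ennreal_1 ennreal_plus)
  qed fact
  \<comment> \<open>The bound \<open>le\<close> makes the hitting times finite, so passing to real
    numbers, where differences make sense, loses nothing.\<close>
  define h where "h v = enn2real (hitting_time G v r)" for v
  have h: "hitting_time G v r = ennreal (h v)" if "v \<in> ?V" for v
    using le_less_trans[OF le[OF that] ennreal_less_top] by (simp add: h_def)
  have h_nonneg: "0 \<le> h v" for v
    by (simp add: h_def)
  have h_step: "(\<Sum>u\<in>?N v. h v - h u) = card (?N v)" if v: "v \<in> ?V" "v \<noteq> r" for v
  proof -
    have "ennreal (h v) = 1 + (\<integral>\<^sup>+u. hitting_time G u r \<partial>measure_pmf (pmf_of_set (?N v)))"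
      using h[OF v(1)] hitting_time_step[OF v(2), of G] by simp
    also have "(\<integral>\<^sup>+u. hitting_time G u r \<partial>measure_pmf (pmf_of_set (?N v)))
        = (\<integral>\<^sup>+u. ennreal (h u) \<partial>measure_pmf (pmf_of_set (?N v)))"
      using h ne[OF v(1)] fin sub by (intro nn_integral_cong_AE) (auto simp: AE_measure_pmf_iff)
    also have "\<dots> = ennreal ((\<Sum>u\<in>?N v. h u) / card (?N v))"
      using v h_nonneg by (intro average)
    also have "1 + \<dots> = ennreal (1 + (\<Sum>u\<in>?N v. h u) / card (?N v))"
      using h_nonneg by (simp add: sum_nonneg flip: ennreal_1 ennreal_plus)
    finally have "h v = 1 + (\<Sum>u\<in>?N v. h u) / card (?N v)"
      using h_nonneg by (subst (asm) ennreal_inj) (auto intro!: add_nonneg_nonneg divide_nonneg_nonneg sum_nonneg)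
    then show ?thesis
      using pos[OF v(1)] by (simp add: sum_subtractf field_simps)
  qed
  \<comment> \<open>Maximum principle for the difference, which is harmonic off the root.\<close>
  define d where "d v = g v - h v" for v
  define M where "M = Max (d ` ?V)"
  have d_le: "d v \<le> M" if "v \<in> ?V" for v
    using \<open>finite ?V\<close> that by (simp add: M_def)
  have d_harm: "(\<Sum>u\<in>?N v. d v - d u) = 0" if v: "v \<in> ?V" "v \<noteq> r" for v
  proof -
    have "(\<Sum>u\<in>?N v. d v - d u) = (\<Sum>u\<in>?N v. g v - g u) - (\<Sum>u\<in>?N v. h v - h u)"
      unfolding d_def sum_subtractf[symmetric] by (intro sum.cong) auto
    then show ?thesis
      using poisson[OF v] h_step[OF v] by simp
  qed
  have "M \<in> d ` ?V"
    unfolding M_def using \<open>finite ?V\<close> r by (intro Max_in) auto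
  then obtain m where m: "m \<in> ?V" "d m = M"
    by (metis imageE)
  have "d r = M"
  proof (rule ccontr)
    assume "d r \<noteq> M"
    \<comment> \<open>At a maximum off the root all terms \<open>d u - d v\<close> are nonnegative
      with sum 0, so every neighbour attains the maximum too; connectedness carries it to
      \<open>r\<close>.\<close>
    have "?V \<subseteq> {v \<in> ?V. d v = M}"
    proof (rule connected_closed_subset[OF G con m(1)])
      fix u v assume u: "u \<in> {v \<in> ?V. d v = M}" and "(u, v) \<in> parcs G"
      then have v: "v \<in> ?N u" "v \<in> ?V"
        using sub by (auto simp: neighbours_def)
      have "u \<noteq> r"
        using u \<open>d r \<noteq> M\<close> by auto
      then have "\<forall>v\<in>?N u. d u - d v = 0"
        using d_harm[of u] u d_le sub fin by (subst (asm) sum_nonneg_eq_0_iff) auto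
      with u v show "v \<in> {v \<in> ?V. d v = M}" by auto
    qed (use m in auto)
    with r \<open>d r \<noteq> M\<close> show False by auto
  qed
  \<comment> \<open>Thus \<open>M \<le> 0\<close>, that is, \<open>g\<close> is at most
    \<open>h\<close> on all vertices.\<close>
  moreover have "d r \<le> 0"
    using h_nonneg[of r] \<open>g r = 0\<close> by (simp add: d_def)
  ultimately have "g v \<le> h v"
    using d_le[OF \<open>v \<in> ?V\<close>] by (simp add: d_def)
  with le[OF \<open>v \<in> ?V\<close>] h[OF \<open>v \<in> ?V\<close>] show ?thesis
    by (simp add: antisym ennreal_leI)
qed

text \<open>
  Leaf removal moves the weight \<open>c l\<close> of a leaf to its parent. For \<open>c = 1\<close> the right-hand side of
  the Poisson equation is the degree; the shift \<open>2 * c v - 2\<close> is what makes the shape of the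
  equation invariant, since the leaf passes its charge \<open>2 * c l - 1\<close> on while the degree of the
  parent drops by one. The leaf contributes \<open>c l * (2 * c l - 1)\<close> to the weighted sum.
\<close>

lemma tree_potential_exists:
  assumes "undirected_tree T" and "r \<in> pverts T" and "\<forall>v\<in>pverts T. 1 \<le> c v"
  shows "\<exists>g :: 'a \<Rightarrow> real. g r = 0 \<and> (\<forall>v\<in>pverts T. 0 \<le> g v) \<and>
     (\<forall>v\<in>pverts T - {r}. (\<Sum>u\<in>neighbours T v. g v - g u)
        = 2 * real (c v) - 2 + card (neighbours T v)) \<and>
     (\<Sum>v\<in>pverts T. c v * g v)
       \<le> (\<Sum>j\<in>{Suc (sum c (pverts T)) - card (pverts T)..<sum c (pverts T)}. j * (2 * real j - 1))"
  using assms
proof (induction "card (pverts T)" arbitrary: T c rule: less_induct)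
  case less
  note T = less.prems(1) and r = less.prems(2) and c = bspec[OF less.prems(3)]
  from T have G: "pair_graph T"
    by (simp add: undirected_tree_def)
  interpret pair_graph T by fact
  let ?V = "pverts T"
  have card_le: "card ?V \<le> sum c ?V"
    using sum_mono[of ?V "\<lambda>_. 1" c] c by simp
  show ?case
  proof (cases "2 \<le> card ?V")
    case False
    then have "card ?V = 1"
      using r pair_finite_verts card_gt_0_iff[of ?V] by fastforce
    with r have "?V = {r}"
      by (auto simp: card_1_singleton_iff)
    \<comment> \<open>The equation has no instance here, and the summation range is
      \<open>{c r..<c r}\<close>, hence empty.\<close>
    then show ?thesis
      by (intro exI[of _ "\<lambda>_. 0"]) (auto intro!: sum_nonneg mult_nonneg_nonneg)
  next
    case True
    from undirected_tree_leaf[OF T this r] obtain l p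
      where l: "l \<in> ?V" "l \<noteq> r" and p: "p \<in> ?V" "p \<noteq> l" and Nl: "neighbours T l = {p}" .
    let ?T = "delete_leaf T l" and ?c = "c(p := c p + c l)"
    have V': "pverts ?T = ?V - {l}"
      by (simp add: delete_leaf_def)
    have fin': "finite (?V - {l})"
      using pair_finite_verts by simp
    have card': "card ?V = Suc (card (?V - {l}))"
      using l pair_finite_verts by (metis card.remove)
    have N': "neighbours ?T v = neighbours T v - {l}" if "v \<in> ?V - {l}" for v
      using that by (auto simp: neighbours_def delete_leaf_def)
    have l_N: "l \<in> neighbours T v \<longleftrightarrow> v = p" for v
      using Nl arcs_symmetric by (auto simp: neighbours_def)
    have split_p: "(\<Sum>v\<in>?V - {l}. f v) = f p + (\<Sum>v\<in>?V - {l} - {p}. f v)"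
      for f :: "'a \<Rightarrow> 'b :: comm_monoid_add"
      using p fin' by (intro sum.remove) auto
    have split_l: "(\<Sum>v\<in>?V. f v) = f l + (\<Sum>v\<in>?V - {l}. f v)" for f :: "'a \<Rightarrow> 'b :: comm_monoid_add"
      using l pair_finite_verts by (intro sum.remove) auto
    \<comment> \<open>The total weight is kept while the number of vertices drops by one, so the
      summation range loses exactly its lowest index.\<close>
    have sum_c': "sum ?c (?V - {l}) = sum c ?V"
      unfolding split_l split_p by (simp add: ac_simps)
    have "card (pverts ?T) < card ?V" and "r \<in> pverts ?T"
      and "\<forall>v\<in>pverts ?T. 1 \<le> ?c v"
      using card' r l(2) c by (auto simp: V' trans_le_add1)
    note IH = less.hyps[where c = ?c, OF this(1) undirected_tree_delete_leaf[OF T l(2) r Nl] this(2,3)]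
    obtain g :: "'a \<Rightarrow> real" where g: "g r = 0" "\<forall>v\<in>?V - {l}. 0 \<le> g v"
        "\<forall>v\<in>?V - {l} - {r}. (\<Sum>u\<in>neighbours ?T v. g v - g u)
            = 2 * real (?c v) - 2 + card (neighbours ?T v)"
        "(\<Sum>v\<in>?V - {l}. ?c v * g v)
          \<le> (\<Sum>j\<in>{Suc (sum c ?V) - card (?V - {l})..<sum c ?V}. j * (2 * real j - 1))"
      using IH unfolding V' sum_c' by (elim exE conjE) (rule that)
    \<comment> \<open>The value at \<open>l\<close> is forced by the equation there: the only
      neighbour is \<open>p\<close>, and the right-hand side is
      \<open>2 * c l - 2 + 1\<close>.\<close>
    define g' where "g' = g(l := g p + 2 * c l - 1)"
    have "(\<Sum>u\<in>neighbours T v. g' v - g' u) = 2 * real (c v) - 2 + card (neighbours T v)"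
      if v: "v \<in> ?V" "v \<noteq> r" for v
    proof (cases "v = l")
      case True
      then show ?thesis
        using p by (simp add: Nl g'_def)
    next
      case False
      have IH: "(\<Sum>u\<in>neighbours T v - {l}. g v - g u) = 2 * real (?c v) - 2 + card (neighbours T v - {l})"
        using bspec[OF g(3), of v] N'[of v] v False by simp
      have sum': "(\<Sum>u\<in>neighbours T v - {l}. g' v - g' u) = (\<Sum>u\<in>neighbours T v - {l}. g v - g u)"
        using False by (intro sum.cong) (auto simp: g'_def)
      show ?thesis
      proof (cases "v = p")
        case True
        \<comment> \<open>The extra term \<open>g' p - g' l\<close> is \<open>1 - 2 * c l\<close>.
          It cancels the surplus \<open>2 * c l\<close> of the lumped weight, and the remaining 1
          accounts for the larger degree.\<close>
        then have "l \<in> neighbours T v" and f: "finite (neighbours T v)"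
          using l_N finite_neighbours[OF G] by auto
        then have "(\<Sum>u\<in>neighbours T v. g' v - g' u)
              = (g' v - g' l) + (\<Sum>u\<in>neighbours T v - {l}. g' v - g' u)"
            and "card (neighbours T v) = Suc (card (neighbours T v - {l}))"
          using sum.remove[OF f \<open>l \<in> neighbours T v\<close>, of "\<lambda>u. g' v - g' u"]
            card.remove[OF f \<open>l \<in> neighbours T v\<close>] by blast+
        then show ?thesis
          using IH v False True sum' by (simp add: g'_def)
      next
        case neq: False
        then have "neighbours T v - {l} = neighbours T v"
          using l_N by auto
        then show ?thesis
          using IH v False neq sum' by simp
      qed
    qed
    moreover have "g' r = 0"
      using g l by (simp add: g'_def)
    moreover have "0 \<le> g' v" if "v \<in> ?V" for v
      using bspec[OF g(2), of v] bspec[OF g(2), of p] p c[of l] l that by (auto simp: g'_def)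
    moreover have "(\<Sum>v\<in>?V. c v * g' v)
        \<le> (\<Sum>j\<in>{Suc (sum c ?V) - card ?V..<sum c ?V}. j * (2 * real j - 1))"
    proof -
      \<comment> \<open>The largest weight a single vertex can have: the total minus at least 1 for
        each other vertex.\<close>
      define m where "m = Suc (sum c ?V) - card ?V"
      have mono: "real a * (2 * real a - 1) \<le> real b * (2 * real b - 1)" if "1 \<le> a" "a \<le> b" for a b
        using that by (intro mult_mono) auto
      have "(\<Sum>v\<in>?V - {l} - {p}. c v * g' v) = (\<Sum>v\<in>?V - {l} - {p}. ?c v * g v)"
        by (intro sum.cong) (auto simp: g'_def)
      \<comment> \<open>The part \<open>c l * g p\<close> of the leaf term merges with
        \<open>c p * g p\<close> into the lumped weight at \<open>p\<close>.\<close>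
      then have "(\<Sum>v\<in>?V. c v * g' v) = c l * (2 * real (c l) - 1) + (\<Sum>v\<in>?V - {l}. ?c v * g v)"
        unfolding split_l split_p using p by (simp add: g'_def algebra_simps)
      also have "c l \<le> m"
        unfolding m_def using sum_mono[of "?V - {l}" "\<lambda>_. 1" c] c card' split_l[of c] by simp
      then have "c l * (2 * real (c l) - 1) \<le> m * (2 * real m - 1)"
        using c[of l] l by (intro mono) auto
      also note g(4)
      also have "m * (2 * real m - 1)
          + (\<Sum>j\<in>{Suc (sum c ?V) - card (?V - {l})..<sum c ?V}. j * (2 * real j - 1))
        = (\<Sum>j\<in>{m..<sum c ?V}. j * (2 * real j - 1))"
      proof -
        have "m < sum c ?V" and "Suc (sum c ?V) - card (?V - {l}) = Suc m"
          unfolding m_def using True card_le card' by auto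
        then show ?thesis
          by (simp add: sum.atLeast_Suc_lessThan)
      qed
      finally show ?thesis unfolding m_def by simp
    qed
    ultimately show ?thesis
      by (intro exI[of _ g']) auto
  qed
qed

section \<open>The upper bound for trees\<close>

lemma sum_odd_multiples:
  "(\<Sum>j\<in>{1..<n}. j * (2 * real j - 1)) = real n * (real n - 1) * (4 * real n - 5) / 6"
proof (cases n)
  case (Suc m)
  have "(\<Sum>j\<in>{1..<Suc m}. j * (2 * real j - 1)) = real (Suc m) * real m * (4 * real m - 1) / 6"
    by (induction m) (simp_all add: field_simps)
  with Suc show ?thesis by (simp add: algebra_simps)
qed simp

lemma reverse_cover_cost_eqI:
  fixes g :: "'a \<Rightarrow> real"
  assumes "pair_graph G" and "Digraph_Component.connected (with_proj G)"
    and "2 \<le> card (pverts G)" and "r \<in> pverts G"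
    and nonneg: "\<And>v. v \<in> pverts G \<Longrightarrow> 0 \<le> g v" and "g r = 0"
    and "\<And>v. v \<in> pverts G \<Longrightarrow> v \<noteq> r \<Longrightarrow>
      (\<Sum>u\<in>neighbours G v. g v - g u) = card (neighbours G v)"
  shows "reverse_cover_cost G r = ennreal (\<Sum>v\<in>pverts G. g v)"
proof -
  have "reverse_cover_cost G r = (\<Sum>v\<in>pverts G. ennreal (g v))"
    unfolding reverse_cover_cost_def
    using assms by (intro sum.cong refl hitting_time_eqI)
  also have "\<dots> = ennreal (\<Sum>v\<in>pverts G. g v)"
    using nonneg by (rule sum_ennreal)
  finally show ?thesis .
qed

text \<open>With unit weights the right-hand side of the weighted equation is the degree, and the
  summation starts at \<open>Suc n - n = 1\<close>.\<close>

lemma reverse_cover_cost_tree_le: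
  assumes T: "undirected_tree T" and n: "card (pverts T) = n" "2 \<le> n" and r: "r \<in> pverts T"
  shows "reverse_cover_cost T r \<le> ennreal (real n * (real n - 1) * (4 * real n - 5) / 6)"
proof -
  obtain g :: "'a \<Rightarrow> real" where g: "g r = 0" "\<And>v. v \<in> pverts T \<Longrightarrow> 0 \<le> g v"
      "\<And>v. v \<in> pverts T \<Longrightarrow> v \<noteq> r \<Longrightarrow>
        (\<Sum>u\<in>neighbours T v. g v - g u) = card (neighbours T v)"
      "(\<Sum>v\<in>pverts T. g v) \<le> (\<Sum>j\<in>{1..<n}. j * (2 * real j - 1))"
    using tree_potential_exists[OF T r, of "\<lambda>_. 1"] n by auto
  have "reverse_cover_cost T r = ennreal (\<Sum>v\<in>pverts T. g v)"
    using T n r g by (intro reverse_cover_cost_eqI) (auto simp: undirected_tree_def)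
  then show ?thesis
    using g(4) unfolding sum_odd_multiples by (simp only: ennreal_leI)
qed

section \<open>Paths\<close>

lemma pverts_path_graph [simp]: "pverts (path_graph xs) = set xs"
  by (simp add: path_graph_def)

lemma parcs_path_graphE:
  assumes "(u, v) \<in> parcs (path_graph xs)"
  obtains i j where "i < length xs" "j < length xs" "u = xs ! i" "v = xs ! j" "j = Suc i \<or> i = Suc j"
proof -
  from assms obtain k where "Suc k < length xs"
      "u = xs ! k \<and> v = xs ! Suc k \<or> u = xs ! Suc k \<and> v = xs ! k"
    by (auto simp: path_graph_def)
  then show thesis
    using that[of k "Suc k"] that[of "Suc k" k] by auto
qed

lemma parcs_path_graph_nth_iff:
  assumes "distinct xs" and "i < length xs" and "j < length xs"
  shows "(xs ! i, xs ! j) \<in> parcs (path_graph xs) \<longleftrightarrow> j = Suc i \<or> i = Suc j"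
proof
  assume "(xs ! i, xs ! j) \<in> parcs (path_graph xs)"
  then obtain a b where "a < length xs" "b < length xs" "xs ! i = xs ! a" "xs ! j = xs ! b"
      "b = Suc a \<or> a = Suc b"
    by (rule parcs_path_graphE)
  with assms show "j = Suc i \<or> i = Suc j"
    by (simp add: nth_eq_iff_index_eq)
next
  assume "j = Suc i \<or> i = Suc j"
  then show "(xs ! i, xs ! j) \<in> parcs (path_graph xs)"
    using assms by (auto simp: path_graph_def)
qed

lemma neighbours_path_graph:
  assumes "distinct xs" and "i < length xs"
  shows "neighbours (path_graph xs) (xs ! i)
    = (!) xs ` {j. j < length xs \<and> (j = Suc i \<or> i = Suc j)}"
proof (intro equalityI subsetI)
  fix v assume "v \<in> neighbours (path_graph xs) (xs ! i)"
  then have arc: "(xs ! i, v) \<in> parcs (path_graph xs)"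
    by (simp add: neighbours_def)
  then obtain j where "j < length xs" "v = xs ! j"
    by (rule parcs_path_graphE)
  with arc parcs_path_graph_nth_iff[OF assms] show
    "v \<in> (!) xs ` {j. j < length xs \<and> (j = Suc i \<or> i = Suc j)}"
    by auto
next
  fix v assume "v \<in> (!) xs ` {j. j < length xs \<and> (j = Suc i \<or> i = Suc j)}"
  with parcs_path_graph_nth_iff[OF assms] show "v \<in> neighbours (path_graph xs) (xs ! i)"
    by (auto simp: neighbours_def)
qed

lemma pair_graph_path_graph:
  assumes "distinct xs"
  shows "pair_graph (path_graph xs)"
proof
  have sub: "parcs (path_graph xs) \<subseteq> set xs \<times> set xs"
    by (auto elim: parcs_path_graphE)
  then show "e \<in> parcs (path_graph xs) \<Longrightarrow> fst e \<in> pverts (path_graph xs)"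
    and "e \<in> parcs (path_graph xs) \<Longrightarrow> snd e \<in> pverts (path_graph xs)" for e
    by auto
  show "finite (pverts (path_graph xs))"
    by simp
  show "finite (parcs (path_graph xs))"
    using sub by (rule finite_subset) simp
  show "fst e \<noteq> snd e" if "e \<in> parcs (path_graph xs)" for e
    using that assms by (cases e) (auto elim!: parcs_path_graphE simp: nth_eq_iff_index_eq)
  show "symmetric (with_proj (path_graph xs))"
    by (auto simp: symmetric_def path_graph_def intro!: symI)
qed

lemma connected_path_graph:
  assumes "distinct xs" and "xs \<noteq> []"
  shows "Digraph_Component.connected (with_proj (path_graph xs))"
proof (rule connectedI_closed_subset[OF pair_graph_path_graph[OF assms(1)]])
  show "xs ! 0 \<in> pverts (path_graph xs)"
    using assms by simp
  fix S assume "xs ! 0 \<in> S"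
    and closed: "\<And>u v. u \<in> S \<Longrightarrow> (u, v) \<in> parcs (path_graph xs) \<Longrightarrow> v \<in> S"
  have "i < length xs \<Longrightarrow> xs ! i \<in> S" for i
  proof (induction i)
    case (Suc i)
    then show ?case
      using closed[of "xs ! i" "xs ! Suc i"] assms(1) by (simp add: parcs_path_graph_nth_iff)
  qed (simp add: \<open>xs ! 0 \<in> S\<close>)
  then show "pverts (path_graph xs) \<subseteq> S"
    by (auto simp: in_set_conv_nth)
qed

text \<open>Turns the recursion of \<open>pcas\<close> into a fact about positions, since the cycle
  argument addresses arcs by index.\<close>

lemma pcas_nth_Suc:
  assumes "pcas u c v" and "Suc i < length c"
  shows "fst (c ! Suc i) = snd (c ! i)"
  using assms
proof (induction c arbitrary: u i)
  case (Cons e c)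
  then show ?case
    by (cases i; cases c) auto
qed simp

lemma pcas_ends:
  assumes "pcas u c v" and "c \<noteq> []"
  shows "fst (c ! 0) = u" and "snd (c ! (length c - 1)) = v"
proof -
  show "fst (c ! 0) = u"
    using assms by (cases c) auto
  have "snd (last c) = v"
    using assms by (induction c arbitrary: u) (auto split: if_splits)
  then show "snd (c ! (length c - 1)) = v"
    using assms by (simp add: last_conv_nth)
qed

text \<open>An extremal argument: two distinct arcs of the cycle would have the same head, although
  a cycle visits its vertices only once.\<close>

lemma path_graph_cycle_length:
  assumes "distinct xs" and cyc: "pre_digraph.cycle (with_proj (path_graph xs)) c"
  shows "length c < 3"
proof (rule ccontr)
  assume "\<not> length c < 3"
  then have k: "3 \<le> length c" by simp
  interpret pair_graph "path_graph xs"
    using assms(1) by (rule pair_graph_path_graph)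
  from cyc obtain u where w: "awalk u c u" and "distinct (tl (pawalk_verts u c))"
    unfolding cycle_def by blast
  then have cas: "pcas u c u" and arcs: "set c \<subseteq> parcs (path_graph xs)"
    by auto
  have "distinct (map snd c)"
    using awalk_verts_conv'[OF cas] \<open>distinct (tl (pawalk_verts u c))\<close> k by (auto split: if_splits)
  then have inj: "i = j" if "snd (c ! i) = snd (c ! j)" "i < length c" "j < length c" for i j
    using that by (simp add: distinct_conv_nth) blast
  define idx where "idx = inv_into {..<length xs} ((!) xs)"
  have idx: "idx (xs ! i) = i" if "i < length xs" for i
    using that inj_on_nth[OF assms(1), of "{..<length xs}"] by (simp add: idx_def inv_into_f_f)
  have arc: "\<exists>a b. c ! i = (xs ! a, xs ! b) \<and> a < length xs \<and> b < length xs \<and> (b = Suc a \<or> a = Suc b)"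
    if "i < length c" for i
  proof -
    have "(fst (c ! i), snd (c ! i)) \<in> parcs (path_graph xs)"
      using arcs that nth_mem by fastforce
    then show ?thesis
      by (rule parcs_path_graphE) (metis prod.collapse)
  qed
  \<comment> \<open>Cyclic successor and predecessor of an arc position.\<close>
  define nxt prv where "nxt i = (if Suc i = length c then 0 else Suc i)"
    and "prv i = (if i = 0 then length c - 1 else i - 1)" for i
  have fst_nxt: "fst (c ! nxt i) = snd (c ! i)" if "i < length c" for i
  proof (cases "Suc i = length c")
    case True
    then have "length c - 1 = i" "c \<noteq> []" by auto
    with True pcas_ends[OF cas] show ?thesis by (simp add: nxt_def)
  next
    case False
    with pcas_nth_Suc[OF cas, of i] that show ?thesis by (simp add: nxt_def)
  qed
  \<comment> \<open>The last claim is where length at least 3 enters: on a cycle of length 2 both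
    positions coincide.\<close>
  have nxt_prv: "nxt (prv i) = i" "prv i < length c" "nxt i < length c" "nxt i \<noteq> prv i"
    if "i < length c" for i
    using that k by (auto simp: nxt_def prv_def)
  \<comment> \<open>Both cycle neighbours of the vertex of largest index would be its predecessor in the path.\<close>
  obtain m where m: "m < length c"
      and max: "\<And>i. i < length c \<Longrightarrow> idx (snd (c ! i)) \<le> idx (snd (c ! m))"
  proof -
    have "\<forall>i. i < length c \<longrightarrow> idx (snd (c ! i)) < length xs"
      using arc idx by fastforce
    then have "\<exists>m. m < length c \<and> (\<forall>i. i < length c \<longrightarrow> idx (snd (c ! i)) \<le> idx (snd (c ! m)))"
      using k by (intro ex_has_greatest_nat[where k = 0 and b = "length xs"]) auto
    then show thesis
      using that by blast
  qed
  obtain a b where ab: "c ! m = (xs ! a, xs ! b)" "a < length xs" "b < length xs" "b = Suc a \<or> a = Suc b"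
    using arc[OF m] by blast
  obtain a' b' where ab': "c ! nxt m = (xs ! a', xs ! b')" "a' < length xs" "b' < length xs"
      "b' = Suc a' \<or> a' = Suc b'"
    using arc[OF nxt_prv(3)[OF m]] by blast
  have "snd (c ! prv m) = xs ! a"
    using fst_nxt[of "prv m"] nxt_prv[OF m] ab by simp
  moreover from this have "a \<le> b"
    using max[of "prv m"] nxt_prv[OF m] ab idx by simp
  then have "b = Suc a"
    using ab by auto
  moreover have "a' = b"
    using fst_nxt[OF m] ab ab' assms(1) by (simp add: nth_eq_iff_index_eq)
  moreover have "b' \<le> b"
    using max[of "nxt m"] nxt_prv[OF m] ab ab' idx by simp
  \<comment> \<open>From \<open>a' = b\<close> and \<open>b' \<le> b\<close> the arc after
    \<open>m\<close> must step down, so \<open>b' = a\<close>.\<close>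
  ultimately have "snd (c ! prv m) = snd (c ! nxt m)"
    using ab' by auto
  then show False
    using inj nxt_prv[OF m] by metis
qed

lemma undirected_tree_path_graph:
  assumes "distinct xs" and "xs \<noteq> []"
  shows "undirected_tree (path_graph xs)"
  using pair_graph_path_graph[OF assms(1)] connected_path_graph[OF assms]
    path_graph_cycle_length[OF assms(1)]
  unfolding undirected_tree_def by (meson not_le)

text \<open>Carries the computation at the head of the list over to its last element.\<close>

lemma path_graph_rev: "path_graph (rev xs) = path_graph xs"
proof -
  have "parcs (path_graph (rev ys)) \<subseteq> parcs (path_graph ys)" for ys :: "'a list"
  proof clarify
    fix u v assume "(u, v) \<in> parcs (path_graph (rev ys))"
    then obtain i where i: "Suc i < length ys"
        "(u, v) \<in> {(rev ys ! i, rev ys ! Suc i), (rev ys ! Suc i, rev ys ! i)}"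
      by (auto simp: path_graph_def)
    \<comment> \<open>Reversal takes positions \<open>i\<close> and \<open>Suc i\<close> to
      \<open>Suc j\<close> and \<open>j\<close>.\<close>
    define j where "j = length ys - Suc (Suc i)"
    have "rev ys ! i = ys ! Suc j" "rev ys ! Suc i = ys ! j" "Suc j < length ys"
      using i(1) by (auto simp: j_def rev_nth Suc_diff_Suc)
    with i(2) show "(u, v) \<in> parcs (path_graph ys)"
      by (auto simp: path_graph_def)
  qed
  from this[of xs] this[of "rev xs"] show ?thesis
    by (simp add: path_graph_def subset_antisym)
qed

section \<open>The value attained at the ends of a path\<close>

lemma sum_path_hitting_times:
  "(\<Sum>i<n. real i * (2 * (real n - 1) - real i)) = real n * (real n - 1) * (4 * real n - 5) / 6"
proof -
  \<comment> \<open>The constant is decoupled from the number of terms; otherwise the summand would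
    change in the induction step.\<close>
  have "(\<Sum>i<m. real i * (c - real i)) = real m * (real m - 1) * (3 * c - 2 * real m + 1) / 6" for m c
    by (induction m) (simp_all add: field_simps)
  from this[of "2 * (real n - 1)" n] show ?thesis
    by (simp add: algebra_simps)
qed

lemma reverse_cover_cost_path_graph_hd:
  assumes xs: "distinct xs" "length xs = n" and n: "2 \<le> n"
  shows "reverse_cover_cost (path_graph xs) (hd xs)
    = ennreal (real n * (real n - 1) * (4 * real n - 5) / 6)"
proof -
  define idx where "idx = inv_into {..<n} ((!) xs)"
  have inj: "inj_on ((!) xs) {..<n}"
    using xs by (intro inj_on_nth) auto
  then have idx: "idx (xs ! i) = i" if "i < n" for i
    using that by (simp add: idx_def inv_into_f_f)
  \<comment> \<open>The second difference of \<open>f\<close> is -2, which matches degree 2 at inner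
    vertices; the constant \<open>2 * (real n - 1)\<close> makes the last increment 1, the degree of
    the far end.\<close>
  define f where "f i = real i * (2 * (real n - 1) - real i)" for i
  define g where "g v = f (idx v)" for v
  have g: "g (xs ! i) = f i" if "i < n" for i
    using that by (simp add: g_def idx)
  have hd: "hd xs = xs ! 0"
    using xs n by (intro hd_conv_nth) auto
  have verts: "set xs = (!) xs ` {..<n}"
    using xs by (auto simp: set_conv_nth)
  have "reverse_cover_cost (path_graph xs) (hd xs) = ennreal (\<Sum>v\<in>pverts (path_graph xs). g v)"
  proof (rule reverse_cover_cost_eqI)
    have "xs \<noteq> []"
      using xs n by auto
    then show "pair_graph (path_graph xs)" "Digraph_Component.connected (with_proj (path_graph xs))"
      using xs(1) by (simp_all add: pair_graph_path_graph connected_path_graph)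
    show "2 \<le> card (pverts (path_graph xs))" "hd xs \<in> pverts (path_graph xs)"
      using xs n \<open>xs \<noteq> []\<close> by (simp_all add: distinct_card)
    show "g (hd xs) = 0"
      using n by (simp add: hd g f_def)
  next
    fix v assume "v \<in> pverts (path_graph xs)"
    then obtain i where i: "v = xs ! i" "i < n"
      by (auto simp: verts)
    show "0 \<le> g v"
      using i by (simp add: g f_def)
    assume "v \<noteq> hd xs"
    with i have "i \<noteq> 0"
      using hd by metis
    let ?J = "{j. j < n \<and> (j = Suc i \<or> i = Suc j)}"
    have N: "neighbours (path_graph xs) v = (!) xs ` ?J"
      using neighbours_path_graph[of xs i] xs i by simp
    have injJ: "inj_on ((!) xs) ?J"
      by (rule inj_on_subset[OF inj]) auto
    have "(\<Sum>u\<in>neighbours (path_graph xs) v. g v - g u) = (\<Sum>j\<in>?J. f i - f j)"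
      unfolding N sum.reindex[OF injJ] using i by (intro sum.cong) (auto simp: g)
    also have "\<dots> = card ?J"
    proof (cases "Suc i < n")
      case True
      then have J: "?J = {i - 1, Suc i}"
        using \<open>i \<noteq> 0\<close> by auto
      show ?thesis
        unfolding J using \<open>i \<noteq> 0\<close> by (simp add: f_def of_nat_diff algebra_simps)
    next
      case False
      then have J: "?J = {i - 1}" and "n = Suc i"
        using \<open>i \<noteq> 0\<close> i by auto
      then show ?thesis
        unfolding J using \<open>i \<noteq> 0\<close> by (simp add: f_def of_nat_diff algebra_simps)
    qed
    also have "card ?J = card (neighbours (path_graph xs) v)"
      unfolding N by (rule card_image[OF injJ, symmetric])
    finally show "(\<Sum>u\<in>neighbours (path_graph xs) v. g v - g u) = card (neighbours (path_graph xs) v)" .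
  qed
  also have "(\<Sum>v\<in>pverts (path_graph xs). g v) = (\<Sum>i<n. f i)"
    unfolding pverts_path_graph verts sum.reindex[OF inj] by (simp add: g)
  also have "\<dots> = real n * (real n - 1) * (4 * real n - 5) / 6"
    unfolding f_def by (rule sum_path_hitting_times)
  finally show ?thesis .
qed

lemma reverse_cover_cost_path_graph:
  assumes "distinct xs" "length xs = n" "2 \<le> n" "r = hd xs \<or> r = last xs"
  shows "reverse_cover_cost (path_graph xs) r
    = ennreal (real n * (real n - 1) * (4 * real n - 5) / 6)"
  using assms reverse_cover_cost_path_graph_hd[of xs n] reverse_cover_cost_path_graph_hd[of "rev xs" n]
  by (auto simp: path_graph_rev hd_rev)

text \<open>Attainment is stated over \<open>nat\<close> because \<open>'a\<close> may have fewer
  than \<open>n\<close> elements; the last conjunct covers every path that does exist over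
  \<open>'a\<close>, at both ends.\<close>

theorem theorem16:
  fixes n :: nat
  assumes "2 \<le> n"
  shows "(\<forall>(T :: 'a pair_pre_digraph) r.
            undirected_tree T \<and> card (pverts T) = n \<and> r \<in> pverts T \<longrightarrow>
            reverse_cover_cost T r \<le> ennreal (real n * (real n - 1) * (4 * real n - 5) / 6)) \<and>
         (\<exists>(T :: nat pair_pre_digraph) r.
            undirected_tree T \<and> card (pverts T) = n \<and> r \<in> pverts T \<and>
            reverse_cover_cost T r = ennreal (real n * (real n - 1) * (4 * real n - 5) / 6)) \<and>
         (\<forall>(xs :: 'a list) r.
            distinct xs \<and> length xs = n \<and> (r = hd xs \<or> r = last xs) \<longrightarrow>
            undirected_tree (path_graph xs) \<and> card (pverts (path_graph xs)) = n \<and>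
            r \<in> pverts (path_graph xs) \<and>
            reverse_cover_cost (path_graph xs) r =
              ennreal (real n * (real n - 1) * (4 * real n - 5) / 6))"
proof (intro conjI allI impI)
  fix T :: "'a pair_pre_digraph" and r
  assume "undirected_tree T \<and> card (pverts T) = n \<and> r \<in> pverts T"
  then show "reverse_cover_cost T r \<le> ennreal (real n * (real n - 1) * (4 * real n - 5) / 6)"
    using assms by (auto intro: reverse_cover_cost_tree_le)
next
  let ?xs = "[0..<n]"
  have "distinct ?xs" "length ?xs = n" "?xs \<noteq> []" "hd ?xs \<in> set ?xs"
    using assms by auto
  then show "\<exists>(T :: nat pair_pre_digraph) r.
      undirected_tree T \<and> card (pverts T) = n \<and> r \<in> pverts T \<and>
      reverse_cover_cost T r = ennreal (real n * (real n - 1) * (4 * real n - 5) / 6)"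
    using undirected_tree_path_graph[of ?xs] reverse_cover_cost_path_graph_hd[of ?xs n] assms
    by (intro exI[of _ "path_graph ?xs"] exI[of _ "hd ?xs"]) (simp add: distinct_card)
next
  fix xs :: "'a list" and r
  assume *: "distinct xs \<and> length xs = n \<and> (r = hd xs \<or> r = last xs)"
  then have "xs \<noteq> []"
    using assms by auto
  show "undirected_tree (path_graph xs)"
    using * \<open>xs \<noteq> []\<close> by (simp add: undirected_tree_path_graph)
  show "card (pverts (path_graph xs)) = n"
    using * by (simp add: distinct_card)
  show "r \<in> pverts (path_graph xs)"
    using * \<open>xs \<noteq> []\<close> by auto
  show "reverse_cover_cost (path_graph xs) r
      = ennreal (real n * (real n - 1) * (4 * real n - 5) / 6)"
    using * assms by (intro reverse_cover_cost_path_graph) auto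
qed

end
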